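(* Consider the generalized ARCH model $$X_t=\sigma_t\epsilon_t,\qquad \sigma_t^2=\alpha_0+\alpha_1X_{t-1}^2+l_1L_{t-1},\qquad t\in\mathbb{Z},$$ with $\alpha_0\ge 0$, $\alpha_1,l_1>0$, $\alpha_1<1$ and $\mathbb{E}(L_0^2)<\infty$, where $(\sigma_t^2)_{t\in\mathbb{Z}}$ is the strictly stationary solution $$\sigma_{t+1}^2=\sum_{i=0}^\infty\left(\prod_{j=0}^{i-1}\alpha_1\epsilon_{t-j}^2\right)(\alpha_0+l_1L_{t-i}).$$ Let $\gamma$ and $s$ denote the autocovariance functions of $(X_t^2)_{t\in\mathbb{Z}}$ and $(L_t)_{t\in\mathbb{Z}}$, respectively. Suppose $\mathbb{E}(\epsilon_0^4)<\infty$ and $\alpha_1<\frac{1}{\sqrt{\mathbb{E}(\epsilon_0^4)}}$. Then for any integer $n\neq 0$, $$\alpha_1^2\gamma(n)-\alpha_1\bigl(\gamma(n+1)+\gamma(n-1)\bigr)+\gamma(n)-l_1^2s(n)=0,$$ and for $n=0$, $$\alpha_1^2\gamma(0)-2\alpha_1\gamma(1)+\gamma(0)-\frac{\mathbb{E}(X_0^4)\,\mathrm{Var}(\epsilon_0^2)}{\mathbb{E}(\epsilon_0^4)}-l_1^2s(0)=0.$$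
   Context: Standing assumptions on the model: $(\epsilon_t)_{t\in\mathbb{Z}}$ is an i.i.d. process with $\mathbb{E}(\epsilon_0)=0$ and $\mathbb{E}(\epsilon_0^2)=1$; $(L_t)_{t\in\mathbb{Z}}$ (the liquidity) is a strictly stationary positive process with $\mathbb{E}(L_0)=1$, independent of $(\epsilon_t)_{t\in\mathbb{Z}}$. The empty product is $1$. Explicitly, for $n\in\mathbb{Z}$ (and any $t$), $\gamma(n)=\mathbb{E}(X_t^2X_{t+n}^2)-\left(\frac{\alpha_0+l_1}{1-\alpha_1}\right)^2$, where $\mathbb{E}(X_t^2)=\frac{\alpha_0+l_1}{1-\alpha_1}$, and $s(n)=\mathbb{E}(L_tL_{t+n})-1$. *)

theory Defs
  imports "HOL-Probability.Probability"
begin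

definition iid_process :: "'a measure \<Rightarrow> (int \<Rightarrow> 'a \<Rightarrow> real) \<Rightarrow> bool" where
  "iid_process M Y \<longleftrightarrow>
     prob_space.indep_vars M (\<lambda>_. borel) Y UNIV \<and>
     (\<forall>t. distr M borel (Y t) = distr M borel (Y 0))"

definition strictly_stationary :: "'a measure \<Rightarrow> (int \<Rightarrow> 'a \<Rightarrow> real) \<Rightarrow> bool" where
  "strictly_stationary M Y \<longleftrightarrow>
     (\<forall>t. Y t \<in> borel_measurable M) \<and>
     (\<forall>J h. finite J \<longrightarrow>
        distr M (\<Pi>\<^sub>M t\<in>J. borel) (\<lambda>\<omega>. \<lambda>t\<in>J. Y (t + h) \<omega>) =
        distr M (\<Pi>\<^sub>M t\<in>J. borel) (\<lambda>\<omega>. \<lambda>t\<in>J. Y t \<omega>))"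

definition independent_processes ::
  "'a measure \<Rightarrow> (int \<Rightarrow> 'a \<Rightarrow> real) \<Rightarrow> (int \<Rightarrow> 'a \<Rightarrow> real) \<Rightarrow> bool" where
  "independent_processes M Y Z \<longleftrightarrow>
     prob_space.indep_var M
       (\<Pi>\<^sub>M t\<in>UNIV. borel) (\<lambda>\<omega> t. Y t \<omega>)
       (\<Pi>\<^sub>M t\<in>UNIV. borel) (\<lambda>\<omega> t. Z t \<omega>)"

definition covariance :: "'a measure \<Rightarrow> ('a \<Rightarrow> real) \<Rightarrow> ('a \<Rightarrow> real) \<Rightarrow> real" where
  "covariance M U V =
     (\<integral>\<omega>. (U \<omega> - (\<integral>\<omega>. U \<omega> \<partial>M)) * (V \<omega> - (\<integral>\<omega>. V \<omega> \<partial>M)) \<partial>M)"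

(* The autocovariance at lag n is the covariance of Y t and Y (t + n), which must not depend on t.
   The definite description makes this explicit: the value is meaningful only if all times t
   give the same covariance. *)
definition autocovariance :: "'a measure \<Rightarrow> (int \<Rightarrow> 'a \<Rightarrow> real) \<Rightarrow> int \<Rightarrow> real" where
  "autocovariance M Y n = (THE c. \<forall>t. covariance M (Y t) (Y (t + n)) = c)"

(* Equations between random variables are understood almost surely. *)
definition generalized_arch_model ::
  "'a measure \<Rightarrow> real \<Rightarrow> real \<Rightarrow> real \<Rightarrow> (int \<Rightarrow> 'a \<Rightarrow> real) \<Rightarrow> (int \<Rightarrow> 'a \<Rightarrow> real) \<Rightarrow>
   (int \<Rightarrow> 'a \<Rightarrow> real) \<Rightarrow> (int \<Rightarrow> 'a \<Rightarrow> real) \<Rightarrow> bool" where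
  "generalized_arch_model M \<alpha>\<^sub>0 \<alpha>\<^sub>1 l\<^sub>1 \<epsilon> L \<sigma> X \<longleftrightarrow>
     (\<forall>t. \<sigma> t \<in> borel_measurable M \<and> X t \<in> borel_measurable M) \<and>
     (\<forall>t. AE \<omega> in M. X t \<omega> = \<sigma> t \<omega> * \<epsilon> t \<omega>) \<and>
     (\<forall>t. AE \<omega> in M. (\<sigma> t \<omega>)\<^sup>2 = \<alpha>\<^sub>0 + \<alpha>\<^sub>1 * (X (t - 1) \<omega>)\<^sup>2 + l\<^sub>1 * L (t - 1) \<omega>)"

end

theory Submission
  imports Defs
begin

text \<open>
  By the series representation, \<open>\<sigma>\<^sub>t\<^sup>2\<close> is a function of the liquidity and of the noise before time
  \<open>t\<close>. Shift invariance of the joint law of liquidity and noise makes \<open>X\<^sub>t\<^sup>2\<close> strictly stationary, and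
  a Cauchy-Schwarz inequality with geometric weights \<open>(\<alpha>\<^sub>1 E(\<epsilon>\<^sub>0\<^sup>4)\<^sup>1\<^sup>/\<^sup>2)\<^sup>i\<close> puts \<open>\<sigma>\<^sub>t\<^sup>2\<close> in \<open>L\<^sup>2\<close>. With
  \<open>D\<^sub>t = \<sigma>\<^sub>t\<^sup>2 (\<epsilon>\<^sub>t\<^sup>2 - 1)\<close> (called \<open>innov\<close>), the model says that the centred processes \<open>y\<close> of \<open>X\<^sup>2\<close> and \<open>\<Lambda>\<close> of \<open>L\<close>
  satisfy \<open>y\<^sub>t - \<alpha>\<^sub>1 y\<^sub>t\<^sub>-\<^sub>1 = l\<^sub>1 \<Lambda>\<^sub>t\<^sub>-\<^sub>1 + D\<^sub>t\<close>. The \<open>D\<^sub>t\<close> are pairwise orthogonal and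
  orthogonal to the liquidity, so the claim follows by multiplying this equation at times
  \<open>0\<close> and \<open>n\<close> and taking expectations.
\<close>

section \<open>Independence of random variables with values in different spaces\<close>

text \<open>The library's \<^const>\<open>prob_space.indep_var\<close> forces both variables to take values in the same type.\<close>

definition (in prob_space) indep_rv ::
  "'b measure \<Rightarrow> ('a \<Rightarrow> 'b) \<Rightarrow> 'c measure \<Rightarrow> ('a \<Rightarrow> 'c) \<Rightarrow> bool" where
  "indep_rv S U T V \<longleftrightarrow> random_variable S U \<and> random_variable T V \<and>
     distr M S U \<Otimes>\<^sub>M distr M T V = distr M (S \<Otimes>\<^sub>M T) (\<lambda>\<omega>. (U \<omega>, V \<omega>))"

lemma (in prob_space) indep_rv_iff_indep_var: "indep_rv S U T V \<longleftrightarrow> indep_var S U T V"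
  by (simp add: indep_rv_def indep_var_distribution_eq)

text \<open>Products commute with images: the product of two image measures is the image of the
  product measure under the pair of maps.\<close>

lemma (in prob_space) indep_rv_compose:
  assumes "indep_rv S U T V" and [measurable]: "f \<in> S \<rightarrow>\<^sub>M S'" "g \<in> T \<rightarrow>\<^sub>M T'"
  shows "indep_rv S' (\<lambda>\<omega>. f (U \<omega>)) T' (\<lambda>\<omega>. g (V \<omega>))"
proof -
  have [measurable]: "random_variable S U" "random_variable T V" and
    law: "distr M S U \<Otimes>\<^sub>M distr M T V = distr M (S \<Otimes>\<^sub>M T) (\<lambda>\<omega>. (U \<omega>, V \<omega>))"
    using assms(1) by (simp_all add: indep_rv_def)
  have "distr M S' (\<lambda>\<omega>. f (U \<omega>)) \<Otimes>\<^sub>M distr M T' (\<lambda>\<omega>. g (V \<omega>)) =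
      distr (distr M S U) S' f \<Otimes>\<^sub>M distr (distr M T V) T' g"
    by (simp add: distr_distr comp_def)
  also have "\<dots> = distr (distr M S U \<Otimes>\<^sub>M distr M T V) (S' \<Otimes>\<^sub>M T') (\<lambda>(x, y). (f x, g y))"
    by (intro pair_measure_distr prob_space_imp_sigma_finite prob_space.prob_space_distr
          prob_space_distr) simp_all
  also have "\<dots> = distr M (S' \<Otimes>\<^sub>M T') (\<lambda>\<omega>. (f (U \<omega>), g (V \<omega>)))"
    unfolding law by (subst distr_distr) (simp_all add: comp_def)
  finally show ?thesis
    by (simp add: indep_rv_def)
qed

text \<open>The law of the triple is a threefold product measure, which can be bracketed either way.
  This allows the present noise to be split off from liquidity and past noise taken
  together.\<close>

lemma (in prob_space) indep_rv_assoc: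
  assumes XYZ: "indep_rv A X (B \<Otimes>\<^sub>M C) (\<lambda>\<omega>. (Y \<omega>, Z \<omega>))" and YZ: "indep_rv B Y C Z"
  shows "indep_rv (A \<Otimes>\<^sub>M B) (\<lambda>\<omega>. (X \<omega>, Y \<omega>)) C Z"
proof -
  have [measurable]: "random_variable A X" "random_variable B Y" "random_variable C Z"
    using XYZ YZ by (simp_all add: indep_rv_def)
  have XY: "indep_rv A X B Y"
    using indep_rv_compose[OF XYZ measurable_ident measurable_fst] by simp
  let ?PX = "distr M A X" and ?PY = "distr M B Y" and ?PZ = "distr M C Z"
  interpret PX: prob_space ?PX by (rule prob_space_distr) simp
  interpret PY: prob_space ?PY by (rule prob_space_distr) simp
  interpret PZ: prob_space ?PZ by (rule prob_space_distr) simp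
  interpret YZ: prob_space "?PY \<Otimes>\<^sub>M ?PZ" by (rule prob_space_pair) unfold_locales
  have distr_XY: "?PX \<Otimes>\<^sub>M ?PY = distr M (A \<Otimes>\<^sub>M B) (\<lambda>\<omega>. (X \<omega>, Y \<omega>))"
    using XY by (simp add: indep_rv_def)
  have distr_YZ: "?PY \<Otimes>\<^sub>M ?PZ = distr M (B \<Otimes>\<^sub>M C) (\<lambda>\<omega>. (Y \<omega>, Z \<omega>))"
    using YZ by (simp add: indep_rv_def)
  have distr_XYZ: "?PX \<Otimes>\<^sub>M (?PY \<Otimes>\<^sub>M ?PZ) =
      distr M (A \<Otimes>\<^sub>M (B \<Otimes>\<^sub>M C)) (\<lambda>\<omega>. (X \<omega>, Y \<omega>, Z \<omega>))"
    using XYZ by (simp add: indep_rv_def distr_YZ)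
  have "(?PX \<Otimes>\<^sub>M ?PY) \<Otimes>\<^sub>M ?PZ = distr M ((A \<Otimes>\<^sub>M B) \<Otimes>\<^sub>M C) (\<lambda>\<omega>. ((X \<omega>, Y \<omega>), Z \<omega>))"
  proof (rule pair_measure_eqI)
    show "sigma_finite_measure (?PX \<Otimes>\<^sub>M ?PY)"
      unfolding distr_XY by (intro prob_space_imp_sigma_finite prob_space_distr) simp
    show "sigma_finite_measure ?PZ" ..
    show "sets ((?PX \<Otimes>\<^sub>M ?PY) \<Otimes>\<^sub>M ?PZ) = sets (distr M ((A \<Otimes>\<^sub>M B) \<Otimes>\<^sub>M C) (\<lambda>\<omega>. ((X \<omega>, Y \<omega>), Z \<omega>)))"
      by (simp cong: sets_pair_measure_cong)
    fix E F assume "E \<in> sets (?PX \<Otimes>\<^sub>M ?PY)" "F \<in> sets ?PZ"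
    then have E: "E \<in> sets (A \<Otimes>\<^sub>M B)" and F[measurable]: "F \<in> sets C"
      by (simp_all cong: sets_pair_measure_cong)
    note [measurable] = E
    \<comment> \<open>\<open>?G\<close> is \<open>E \<times> F\<close> re-bracketed as a subset of
      the right-nested product, where the law of the triple is already known to factor.\<close>
    let ?G = "{p \<in> space (A \<Otimes>\<^sub>M (B \<Otimes>\<^sub>M C)). (fst p, fst (snd p)) \<in> E \<and> snd (snd p) \<in> F}"
    have G: "?G \<in> sets (A \<Otimes>\<^sub>M (B \<Otimes>\<^sub>M C))"
      by measurable
    have slice: "Pair x -` ?G = (Pair x -` E) \<times> F" if "x \<in> space A" for x
      using that sets.sets_into_space[OF E] sets.sets_into_space[OF F]
      by (auto simp: space_pair_measure)
    have "emeasure (distr M ((A \<Otimes>\<^sub>M B) \<Otimes>\<^sub>M C) (\<lambda>\<omega>. ((X \<omega>, Y \<omega>), Z \<omega>))) (E \<times> F) =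
        emeasure (distr M (A \<Otimes>\<^sub>M (B \<Otimes>\<^sub>M C)) (\<lambda>\<omega>. (X \<omega>, Y \<omega>, Z \<omega>))) ?G"
      using measurable_space[of X M A] measurable_space[of Y M B] measurable_space[of Z M C]
      by (subst (1 2) emeasure_distr)
         (auto intro!: arg_cong2[where f = emeasure] G simp: space_pair_measure)
    \<comment> \<open>Slicing along the first coordinate: by \<open>slice\<close> each section of
      \<open>?G\<close> is a rectangle, so its measure is a product.\<close>
    also have "\<dots> = (\<integral>\<^sup>+x. emeasure (?PY \<Otimes>\<^sub>M ?PZ) (Pair x -` ?G) \<partial>?PX)"
      unfolding distr_XYZ[symmetric] using G
      by (intro YZ.emeasure_pair_measure_alt) (simp cong: sets_pair_measure_cong)
    also have "\<dots> = (\<integral>\<^sup>+x. emeasure ?PY (Pair x -` E) * emeasure ?PZ F \<partial>?PX)"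
    proof (rule nn_integral_cong)
      fix x assume "x \<in> space ?PX"
      then have x: "x \<in> space A" by simp
      have "Pair x -` E \<in> sets B"
        using E by (rule sets_Pair1)
      then show "emeasure (?PY \<Otimes>\<^sub>M ?PZ) (Pair x -` ?G) =
          emeasure ?PY (Pair x -` E) * emeasure ?PZ F"
        unfolding slice[OF x] by (intro PZ.emeasure_pair_measure_Times) simp_all
    qed
    also have "\<dots> = (\<integral>\<^sup>+x. emeasure ?PY (Pair x -` E) \<partial>?PX) * emeasure ?PZ F"
      using E by (intro nn_integral_multc PY.measurable_emeasure_Pair)
        (simp cong: sets_pair_measure_cong)
    also have "\<dots> = emeasure (?PX \<Otimes>\<^sub>M ?PY) E * emeasure ?PZ F"
      using E by (subst PY.emeasure_pair_measure_alt) (simp_all cong: sets_pair_measure_cong)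
    finally show "emeasure (?PX \<Otimes>\<^sub>M ?PY) E * emeasure ?PZ F =
        emeasure (distr M ((A \<Otimes>\<^sub>M B) \<Otimes>\<^sub>M C) (\<lambda>\<omega>. ((X \<omega>, Y \<omega>), Z \<omega>))) (E \<times> F)" ..
  qed
  then show ?thesis
    by (simp add: indep_rv_def distr_XY)
qed

section \<open>Strict stationarity in terms of laws on path space\<close>

text \<open>A finite measure on path space is determined by its values on cylinders with finite base
  \<open>J\<close>, and on these only the finite-dimensional laws matter.\<close>

lemma (in prob_space) strictly_stationary_distr_shift:
  assumes Y: "strictly_stationary M Y"
  shows "distr M (\<Pi>\<^sub>M t\<in>UNIV. borel) (\<lambda>\<omega> t. Y (t + h) \<omega>) =
    distr M (\<Pi>\<^sub>M t\<in>UNIV. borel) (\<lambda>\<omega> t. Y t \<omega>)"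
proof (rule measure_eqI_PiM_infinite[where I = UNIV and M = "\<lambda>_. borel"])
  have [measurable]: "Y t \<in> borel_measurable M" for t
    using Y by (simp add: strictly_stationary_def)
  have [measurable]: "(\<lambda>\<omega> t. Y (t + k) \<omega>) \<in> M \<rightarrow>\<^sub>M (\<Pi>\<^sub>M t\<in>UNIV. borel)" for k
    by (rule measurable_PiM_single') auto
  show "finite_measure (distr M (\<Pi>\<^sub>M t\<in>UNIV. borel) (\<lambda>\<omega> t. Y (t + h) \<omega>))"
    by (intro prob_space.finite_measure prob_space_distr) simp
  fix A :: "int \<Rightarrow> real set" and J :: "int set"
  assume J: "finite J" and A: "\<And>i. i \<in> J \<Longrightarrow> A i \<in> sets borel"
  have eq: "emeasure (distr M (\<Pi>\<^sub>M t\<in>UNIV. borel) (\<lambda>\<omega> t. Y (t + k) \<omega>))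
       (prod_emb UNIV (\<lambda>_. borel) J (Pi\<^sub>E J A)) =
     emeasure (distr M (\<Pi>\<^sub>M t\<in>J. borel) (\<lambda>\<omega>. \<lambda>t\<in>J. Y (t + k) \<omega>)) (Pi\<^sub>E J A)" for k
  proof -
    have "Pi\<^sub>E J A \<in> sets (\<Pi>\<^sub>M t\<in>J. borel)"
      using J A by (rule sets_PiM_I_finite)
    moreover have "prod_emb UNIV (\<lambda>_. borel) J (Pi\<^sub>E J A) \<in> sets (\<Pi>\<^sub>M t\<in>UNIV. borel)"
      using J A by (intro sets_PiM_I) simp_all
    ultimately show ?thesis
      by (subst (1 2) emeasure_distr)
         (auto intro!: arg_cong2[where f = emeasure] simp: prod_emb_def)
  qed
  show "emeasure (distr M (\<Pi>\<^sub>M t\<in>UNIV. borel) (\<lambda>\<omega> t. Y (t + h) \<omega>))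
       (prod_emb UNIV (\<lambda>_. borel) J (Pi\<^sub>E J A)) =
     emeasure (distr M (\<Pi>\<^sub>M t\<in>UNIV. borel) (\<lambda>\<omega> t. Y t \<omega>))
       (prod_emb UNIV (\<lambda>_. borel) J (Pi\<^sub>E J A))"
    using Y J eq[of h] eq[of 0] by (simp add: strictly_stationary_def)
qed simp_all

text \<open>By independence and equality of the marginals, every shifted finite-dimensional law is
  the same power of the law of \<open>Y 0\<close>.\<close>

lemma (in prob_space) iid_process_strictly_stationary:
  assumes "iid_process M Y"
  shows "strictly_stationary M Y"
  unfolding strictly_stationary_def
proof (intro conjI allI impI)
  have ind: "indep_vars (\<lambda>_. borel) Y UNIV" and
    same: "distr M borel (Y t) = distr M borel (Y 0)" for t
    using assms unfolding iid_process_def by blast+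
  show rv [measurable]: "Y t \<in> borel_measurable M" for t
    using ind by (simp add: indep_vars_def)
  fix J :: "int set" and h :: int
  have ind': "indep_vars (\<lambda>_. borel) (\<lambda>t. Y (t + k)) J" for k
  proof -
    \<comment> \<open>Grouping the indices into the disjoint singletons \<open>{t + k}\<close>
      carries independence over to the shifted family.\<close>
    have "indep_vars (\<lambda>t. \<Pi>\<^sub>M i\<in>{t + k}. borel) (\<lambda>t \<omega>. \<lambda>i\<in>{t + k}. Y i \<omega>) J"
      using ind by (rule indep_vars_restrict) (auto simp: disjoint_family_on_def)
    then have "indep_vars (\<lambda>_. borel) (\<lambda>t \<omega>. (\<lambda>i\<in>{t + k}. Y i \<omega>) (t + k)) J"
      by (rule indep_vars_compose2[where Y = "\<lambda>t f. f (t + k)"]) simp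
    then show ?thesis by simp
  qed
  have law: "distr M (\<Pi>\<^sub>M t\<in>J. borel) (\<lambda>\<omega>. \<lambda>t\<in>J. Y (t + k) \<omega>) = (\<Pi>\<^sub>M t\<in>J. distr M borel (Y 0))"
    if "J \<noteq> {}" for k
    using ind'[of k] indep_vars_iff_distr_eq_PiM'[OF that, where M' = "\<lambda>_. borel" and X = "\<lambda>t. Y (t + k)"]
    by (simp add: same[of "_ + k"])
  show "distr M (\<Pi>\<^sub>M t\<in>J. borel) (\<lambda>\<omega>. \<lambda>t\<in>J. Y (t + h) \<omega>) =
      distr M (\<Pi>\<^sub>M t\<in>J. borel) (\<lambda>\<omega>. \<lambda>t\<in>J. Y t \<omega>)"
    \<comment> \<open>The product formula \<open>law\<close> needs a nonempty index set; for empty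
      \<open>J\<close> both sides are images under the same constant map.\<close>
    using law[of h] law[of 0] by (cases "J = {}") (simp_all add: restrict_def)
qed

text \<open>Before and after the common shift, the joint law is the product of the two path laws,
  and each of these is shift invariant.\<close>

lemma (in prob_space) independent_processes_distr_shift:
  assumes Y: "strictly_stationary M Y" and Z: "strictly_stationary M Z"
    and YZ: "independent_processes M Y Z"
  shows "distr M ((\<Pi>\<^sub>M t\<in>UNIV. borel) \<Otimes>\<^sub>M (\<Pi>\<^sub>M t\<in>UNIV. borel))
      (\<lambda>\<omega>. (\<lambda>t. Y (t + h) \<omega>, \<lambda>t. Z (t + h) \<omega>)) =
    distr M ((\<Pi>\<^sub>M t\<in>UNIV. borel) \<Otimes>\<^sub>M (\<Pi>\<^sub>M t\<in>UNIV. borel)) (\<lambda>\<omega>. (\<lambda>t. Y t \<omega>, \<lambda>t. Z t \<omega>))"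
proof -
  let ?P = "\<Pi>\<^sub>M t\<in>(UNIV::int set). (borel :: real measure)"
  have law: "distr M (?P \<Otimes>\<^sub>M ?P) (\<lambda>\<omega>. (\<lambda>t. Y (t + k) \<omega>, \<lambda>t. Z (t + k) \<omega>)) =
      distr M ?P (\<lambda>\<omega> t. Y t \<omega>) \<Otimes>\<^sub>M distr M ?P (\<lambda>\<omega> t. Z t \<omega>)" for k
  proof -
    have shift: "(\<lambda>f t. f (t + k)) \<in> ?P \<rightarrow>\<^sub>M ?P"
      by (rule measurable_PiM_single') auto
    have "indep_var ?P ((\<lambda>f t. f (t + k)) \<circ> (\<lambda>\<omega> t. Y t \<omega>)) ?P ((\<lambda>f t. f (t + k)) \<circ> (\<lambda>\<omega> t. Z t \<omega>))"
      using YZ shift shift unfolding independent_processes_def by (rule indep_var_compose)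
    then show ?thesis
      unfolding indep_var_distribution_eq
      by (simp add: comp_def strictly_stationary_distr_shift[OF Y] strictly_stationary_distr_shift[OF Z])
  qed
  show ?thesis
    using law[of h] law[of 0] by simp
qed

text \<open>\<open>H\<close> is one fixed functional and time enters only through the shift of both
  paths, so \<open>W\<close> inherits the shift invariance of their joint law.\<close>

lemma (in prob_space) strictly_stationary_factor:
  fixes Y Z W :: "int \<Rightarrow> 'a \<Rightarrow> real"
    and H :: "(int \<Rightarrow> real) \<times> (int \<Rightarrow> real) \<Rightarrow> real"
  assumes Y: "strictly_stationary M Y" and Z: "strictly_stationary M Z"
    and YZ: "independent_processes M Y Z"
    and H [measurable]: "H \<in> borel_measurable ((\<Pi>\<^sub>M t\<in>UNIV. borel) \<Otimes>\<^sub>M (\<Pi>\<^sub>M t\<in>UNIV. borel))"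
    and W [measurable]: "\<And>t. W t \<in> borel_measurable M"
    and W_eq: "\<And>t. AE \<omega> in M. W t \<omega> = H (\<lambda>s. Y (s + t) \<omega>, \<lambda>s. Z (s + t) \<omega>)"
  shows "strictly_stationary M W"
  unfolding strictly_stationary_def
proof (intro conjI allI impI W)
  let ?P = "\<Pi>\<^sub>M t\<in>(UNIV::int set). (borel :: real measure)"
  fix J :: "int set" and h :: int
  assume J: "finite J"
  have [measurable]: "Y t \<in> borel_measurable M" "Z t \<in> borel_measurable M" for t
    using Y Z by (simp_all add: strictly_stationary_def)
  have shift [measurable]: "(\<lambda>f s. f (s + t)) \<in> ?P \<rightarrow>\<^sub>M ?P" for t
    by (rule measurable_PiM_single') auto
  have YZ_meas [measurable]: "(\<lambda>\<omega> s. Y (s + t) \<omega>) \<in> M \<rightarrow>\<^sub>M ?P" "(\<lambda>\<omega> s. Z (s + t) \<omega>) \<in> M \<rightarrow>\<^sub>M ?P" for t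
    by (rule measurable_PiM_single'; simp)+
  \<comment> \<open>\<open>\<Phi>\<close> computes the values at all times in \<open>J\<close> from
    one pair of paths, so a time shift of \<open>W\<close> becomes a shift of the argument of
    \<open>\<Phi>\<close>.\<close>
  define \<Phi> where "\<Phi> p = (\<lambda>t\<in>J. H (\<lambda>s. fst p (s + t), \<lambda>s. snd p (s + t)))" for p
  have \<Phi> [measurable]: "\<Phi> \<in> ?P \<Otimes>\<^sub>M ?P \<rightarrow>\<^sub>M (\<Pi>\<^sub>M t\<in>J. borel)"
    unfolding \<Phi>_def
  proof (rule measurable_restrict)
    fix t
    have "(\<lambda>p. (\<lambda>s. fst p (s + t), \<lambda>s. snd p (s + t))) \<in> ?P \<Otimes>\<^sub>M ?P \<rightarrow>\<^sub>M ?P \<Otimes>\<^sub>M ?P"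
      by (intro measurable_Pair measurable_compose[OF measurable_fst shift]
            measurable_compose[OF measurable_snd shift])
    then show "(\<lambda>p. H (\<lambda>s. fst p (s + t), \<lambda>s. snd p (s + t))) \<in> borel_measurable (?P \<Otimes>\<^sub>M ?P)"
      by (rule measurable_compose) fact
  qed
  have law: "distr M (\<Pi>\<^sub>M t\<in>J. borel) (\<lambda>\<omega>. \<lambda>t\<in>J. W (t + k) \<omega>) =
      distr (distr M (?P \<Otimes>\<^sub>M ?P) (\<lambda>\<omega>. (\<lambda>t. Y t \<omega>, \<lambda>t. Z t \<omega>))) (\<Pi>\<^sub>M t\<in>J. borel) \<Phi>" for k
  proof -
    \<comment> \<open>Since \<open>J\<close> is finite, the exceptional null sets of the single
      times combine into one null set.\<close>
    have "AE \<omega> in M. \<forall>t\<in>J. W (t + k) \<omega> = H (\<lambda>s. Y (s + (t + k)) \<omega>, \<lambda>s. Z (s + (t + k)) \<omega>)"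
      by (intro AE_finite_allI J W_eq)
    then have "AE \<omega> in M. (\<lambda>t\<in>J. W (t + k) \<omega>) = \<Phi> (\<lambda>s. Y (s + k) \<omega>, \<lambda>s. Z (s + k) \<omega>)"
      by eventually_elim (simp add: \<Phi>_def add.assoc cong: restrict_cong)
    then have "distr M (\<Pi>\<^sub>M t\<in>J. borel) (\<lambda>\<omega>. \<lambda>t\<in>J. W (t + k) \<omega>) =
        distr M (\<Pi>\<^sub>M t\<in>J. borel) (\<lambda>\<omega>. \<Phi> (\<lambda>s. Y (s + k) \<omega>, \<lambda>s. Z (s + k) \<omega>))"
      by (intro distr_cong_AE) auto
    also have "\<dots> = distr (distr M (?P \<Otimes>\<^sub>M ?P)
        (\<lambda>\<omega>. (\<lambda>s. Y (s + k) \<omega>, \<lambda>s. Z (s + k) \<omega>))) (\<Pi>\<^sub>M t\<in>J. borel) \<Phi>"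
      by (subst distr_distr) (auto simp: comp_def)
    finally show ?thesis
      by (simp add: independent_processes_distr_shift[OF Y Z YZ])
  qed
  show "distr M (\<Pi>\<^sub>M t\<in>J. borel) (\<lambda>\<omega>. \<lambda>t\<in>J. W (t + h) \<omega>) =
      distr M (\<Pi>\<^sub>M t\<in>J. borel) (\<lambda>\<omega>. \<lambda>t\<in>J. W t \<omega>)"
    using law[of h] law[of 0] by simp
qed

text \<open>Both sides integrate a function of the coordinates \<open>0\<close> and \<open>n\<close>
  against the shift-invariant path law. Two times are what covariances require.\<close>

lemma (in prob_space) strictly_stationary_integral2:
  fixes f :: "real \<Rightarrow> real \<Rightarrow> real"
  assumes Y: "strictly_stationary M Y"
    and f: "(\<lambda>(u, v). f u v) \<in> borel_measurable (borel \<Otimes>\<^sub>M borel)"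
  shows "(\<integral>\<omega>. f (Y s \<omega>) (Y (s + n) \<omega>) \<partial>M) = (\<integral>\<omega>. f (Y t \<omega>) (Y (t + n) \<omega>) \<partial>M)"
proof -
  let ?P = "\<Pi>\<^sub>M t\<in>(UNIV::int set). (borel :: real measure)"
  have [measurable]: "Y t \<in> borel_measurable M" for t
    using Y by (simp add: strictly_stationary_def)
  have meas: "(\<lambda>\<omega> t. Y (t + k) \<omega>) \<in> M \<rightarrow>\<^sub>M ?P" for k
    by (rule measurable_PiM_single') auto
  have "(\<lambda>p :: int \<Rightarrow> real. (p 0, p n)) \<in> ?P \<rightarrow>\<^sub>M borel \<Otimes>\<^sub>M borel"
    by measurable
  from measurable_compose[OF this f] have f': "(\<lambda>p. f (p 0) (p n)) \<in> borel_measurable ?P"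
    by simp
  have "(\<integral>\<omega>. f (Y k \<omega>) (Y (k + n) \<omega>) \<partial>M) = (\<integral>p. f (p 0) (p n) \<partial>distr M ?P (\<lambda>\<omega> t. Y t \<omega>))" for k
    using integral_distr[OF meas[of k] f'] strictly_stationary_distr_shift[OF Y, of k]
    by (simp add: add.commute)
  then show ?thesis
    by simp
qed

lemma (in prob_space) strictly_stationary_distr:
  assumes Y: "strictly_stationary M Y"
  shows "distr M borel (Y t) = distr M borel (Y 0)"
proof -
  let ?P = "\<Pi>\<^sub>M t\<in>(UNIV::int set). (borel :: real measure)"
  have [measurable]: "Y t \<in> borel_measurable M" for t
    using Y by (simp add: strictly_stationary_def)
  have meas: "(\<lambda>\<omega> t. Y (t + k) \<omega>) \<in> M \<rightarrow>\<^sub>M ?P" for k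
    by (rule measurable_PiM_single') auto
  have "distr M borel (Y k) = distr (distr M ?P (\<lambda>\<omega> t. Y t \<omega>)) borel (\<lambda>p. p 0)" for k
    using distr_distr[of "\<lambda>p. p 0" ?P borel "\<lambda>\<omega> t. Y (t + k) \<omega>" M] meas[of k]
      strictly_stationary_distr_shift[OF Y, of k]
    by (simp add: comp_def)
  then show ?thesis by simp
qed

text \<open>Covariances at a given lag do not depend on the base time, so the definite description
  denotes their common value. The base time \<open>t\<close> stays free, to be chosen conveniently
  in each use.\<close>

lemma (in prob_space) strictly_stationary_autocovariance:
  assumes Y: "strictly_stationary M Y"
  shows "autocovariance M Y n = covariance M (Y t) (Y (t + n))"
proof -
  have mean: "expectation (Y s) = expectation (Y 0)" for s
    using strictly_stationary_integral2[OF Y, of "\<lambda>u v. u" s 0 0] by simp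
  have "covariance M (Y s) (Y (s + n)) = covariance M (Y t) (Y (t + n))" for s
    unfolding covariance_def mean[of s] mean[of t] mean[of "s + n"] mean[of "t + n"]
    by (rule strictly_stationary_integral2[OF Y]) measurable
  then show ?thesis
    unfolding autocovariance_def by (intro the_equality) auto
qed

lemma (in prob_space)
  fixes h :: "real \<Rightarrow> real"
  assumes Y: "strictly_stationary M Y" and [measurable]: "h \<in> borel_measurable borel"
  shows strictly_stationary_integrable:
      "integrable M (\<lambda>\<omega>. h (Y t \<omega>)) \<longleftrightarrow> integrable M (\<lambda>\<omega>. h (Y 0 \<omega>))"
    and strictly_stationary_integral: "expectation (\<lambda>\<omega>. h (Y t \<omega>)) = expectation (\<lambda>\<omega>. h (Y 0 \<omega>))"
proof -
  have [measurable]: "Y t \<in> borel_measurable M" for t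
    using Y by (simp add: strictly_stationary_def)
  have law: "distr M borel (Y t) = distr M borel (Y 0)"
    using Y by (rule strictly_stationary_distr)
  have "integrable (distr M borel (Y s)) h \<longleftrightarrow> integrable M (\<lambda>\<omega>. h (Y s \<omega>))" for s
    by (rule integrable_distr_eq) measurable
  from this[of t] this[of 0] show "integrable M (\<lambda>\<omega>. h (Y t \<omega>)) \<longleftrightarrow> integrable M (\<lambda>\<omega>. h (Y 0 \<omega>))"
    unfolding law by blast
  have "(\<integral>x. h x \<partial>distr M borel (Y s)) = expectation (\<lambda>\<omega>. h (Y s \<omega>))" for s
    by (rule integral_distr) measurable
  from this[of t] this[of 0] show "expectation (\<lambda>\<omega>. h (Y t \<omega>)) = expectation (\<lambda>\<omega>. h (Y 0 \<omega>))"
    unfolding law by argo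
qed

section \<open>Square-integrable functions and a series inequality\<close>

lemma integrable_mult_of_squares:
  fixes f g :: "'a \<Rightarrow> real"
  assumes [measurable]: "f \<in> borel_measurable M" "g \<in> borel_measurable M"
    and "integrable M (\<lambda>x. (f x)\<^sup>2)" "integrable M (\<lambda>x. (g x)\<^sup>2)"
  shows "integrable M (\<lambda>x. f x * g x)"
proof (rule Bochner_Integration.integrable_bound)
  show "integrable M (\<lambda>x. (f x)\<^sup>2 + (g x)\<^sup>2)"
    using assms(3,4) by simp
  have "\<bar>a * b\<bar> \<le> a\<^sup>2 + b\<^sup>2" for a b :: real
  proof -
    have "0 \<le> \<bar>a * b\<bar>" "2 * \<bar>a * b\<bar> \<le> a\<^sup>2 + b\<^sup>2"
      using sum_squares_bound[of "\<bar>a\<bar>" "\<bar>b\<bar>"] by (simp_all add: abs_mult mult.assoc)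
    then show ?thesis by linarith
  qed
  then show "AE x in M. norm (f x * g x) \<le> norm ((f x)\<^sup>2 + (g x)\<^sup>2)"
    by simp
qed simp

lemma integrable_square_add:
  fixes f g :: "'a \<Rightarrow> real"
  assumes [measurable]: "f \<in> borel_measurable M" "g \<in> borel_measurable M"
    and "integrable M (\<lambda>x. (f x)\<^sup>2)" "integrable M (\<lambda>x. (g x)\<^sup>2)"
  shows "integrable M (\<lambda>x. (f x + g x)\<^sup>2)"
  using assms integrable_mult_of_squares[OF assms] by (simp add: power2_sum mult.assoc)

text \<open>Cauchy-Schwarz applied to the splitting of \<open>a i\<close> into
  \<open>sqrt (q ^ i)\<close> and \<open>a i / sqrt (q ^ i)\<close>; the squares of the first
  factors sum to at most \<open>1 / (1 - q)\<close>.\<close>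

lemma weighted_Cauchy_Schwarz_suminf:
  fixes a :: "nat \<Rightarrow> real"
  assumes a: "\<And>i. 0 \<le> a i" and q: "0 < q" "q < 1"
    and summable: "summable (\<lambda>i. (a i)\<^sup>2 / q ^ i)"
  shows "(\<Sum>i. a i)\<^sup>2 \<le> (\<Sum>i. (a i)\<^sup>2 / q ^ i) / (1 - q)"
proof -
  define B where "B = (\<Sum>i. (a i)\<^sup>2 / q ^ i) / (1 - q)"
  have partial: "(\<Sum>i<n. a i)\<^sup>2 \<le> B" for n
  proof -
    have "(\<Sum>i<n. a i)\<^sup>2 = (\<Sum>i<n. sqrt (q ^ i) * (a i / sqrt (q ^ i)))\<^sup>2"
      using q by (simp add: field_simps)
    also have "\<dots> \<le> (\<Sum>i<n. (sqrt (q ^ i))\<^sup>2) * (\<Sum>i<n. (a i / sqrt (q ^ i))\<^sup>2)"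
      by (rule Cauchy_Schwarz_ineq_sum)
    also have "\<dots> = (\<Sum>i<n. q ^ i) * (\<Sum>i<n. (a i)\<^sup>2 / q ^ i)"
      using q by (simp add: power_divide)
    also have "\<dots> \<le> (1 / (1 - q)) * (\<Sum>i. (a i)\<^sup>2 / q ^ i)"
    proof (rule mult_mono)
      show "(\<Sum>i<n. q ^ i) \<le> 1 / (1 - q)"
        using sum_le_suminf[of "\<lambda>i. q ^ i" "{..<n}"] q by (simp add: suminf_geometric)
      show "(\<Sum>i<n. (a i)\<^sup>2 / q ^ i) \<le> (\<Sum>i. (a i)\<^sup>2 / q ^ i)"
        using q by (intro sum_le_suminf summable) auto
    qed (use q in \<open>auto intro!: sum_nonneg\<close>)
    finally show ?thesis by (simp add: B_def)
  qed
  then have bound: "(\<Sum>i<n. a i) \<le> sqrt B" for n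
    by (rule real_le_rsqrt)
  \<comment> \<open>Convergence of the series itself follows from the uniform bound on its partial
    sums.\<close>
  have "summable a"
    using a bound by (rule summableI_nonneg_bounded)
  then have "(\<Sum>i. a i) \<le> sqrt B" "0 \<le> (\<Sum>i. a i)"
    using a bound by (auto intro: suminf_le_const suminf_nonneg)
  then have "(\<Sum>i. a i)\<^sup>2 \<le> (sqrt B)\<^sup>2"
    by (intro power_mono)
  also have "\<dots> = B"
    using partial[of 0] by simp
  finally show ?thesis
    by (simp add: B_def)
qed

section \<open>The model, and variables determined by liquidity and past noise\<close>

locale liquidity_arch = prob_space M
  for M :: "'a measure" +
  fixes \<epsilon> L \<sigma> X :: "int \<Rightarrow> 'a \<Rightarrow> real" and \<alpha>\<^sub>0 \<alpha>\<^sub>1 l\<^sub>1 :: real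
  assumes iid: "iid_process M \<epsilon>"
    and noise_sq_integrable: "integrable M (\<lambda>\<omega>. (\<epsilon> 0 \<omega>)\<^sup>2)"
    and noise_sq_mean: "expectation (\<lambda>\<omega>. (\<epsilon> 0 \<omega>)\<^sup>2) = 1"
    and noise_4_integrable: "integrable M (\<lambda>\<omega>. (\<epsilon> 0 \<omega>) ^ 4)"
    and liquidity_stationary: "strictly_stationary M L"
    and liquidity_pos: "\<And>t. AE \<omega> in M. L t \<omega> > 0"
    and liquidity_mean: "expectation (L 0) = 1"
    and liquidity_sq_integrable: "integrable M (\<lambda>\<omega>. (L 0 \<omega>)\<^sup>2)"
    and independent: "independent_processes M L \<epsilon>"
    and coeffs: "\<alpha>\<^sub>0 \<ge> 0" "\<alpha>\<^sub>1 > 0" "l\<^sub>1 > 0" "\<alpha>\<^sub>1 < 1"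
    and \<alpha>\<^sub>1_less: "\<alpha>\<^sub>1 < 1 / sqrt (expectation (\<lambda>\<omega>. (\<epsilon> 0 \<omega>) ^ 4))"
    and model: "generalized_arch_model M \<alpha>\<^sub>0 \<alpha>\<^sub>1 l\<^sub>1 \<epsilon> L \<sigma> X"
    and solution: "\<And>t. AE \<omega> in M. (\<sigma> (t + 1) \<omega>)\<^sup>2 =
      (\<Sum>i. (\<Prod>j<i. \<alpha>\<^sub>1 * (\<epsilon> (t - int j) \<omega>)\<^sup>2) * (\<alpha>\<^sub>0 + l\<^sub>1 * L (t - int i) \<omega>))"
begin

abbreviation seq_space :: "int set \<Rightarrow> (int \<Rightarrow> real) measure" where
  "seq_space I \<equiv> \<Pi>\<^sub>M t\<in>I. borel"

text \<open>The series of \<open>solution\<close> is taken at time \<open>t - 1\<close>, so that the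
  terms with index \<open>t\<close> add up to the square of \<open>\<sigma> t\<close>.\<close>

definition vol_term :: "int \<Rightarrow> nat \<Rightarrow> 'a \<Rightarrow> real" where
  "vol_term t i \<omega> = (\<Prod>j<i. \<alpha>\<^sub>1 * (\<epsilon> (t - 1 - int j) \<omega>)\<^sup>2) * (\<alpha>\<^sub>0 + l\<^sub>1 * L (t - 1 - int i) \<omega>)"

text \<open>A version of the squared volatility that is at every point a function of the liquidity
  and the noise before \<open>t\<close>; with the square of \<open>\<sigma> t\<close> it agrees
  almost surely.\<close>

definition vol :: "int \<Rightarrow> 'a \<Rightarrow> real" where
  "vol t \<omega> = (\<Sum>i. vol_term t i \<omega>)"

text \<open>All of the liquidity process is admitted, not only its past: it is independent of the noise, and
  products \<open>L\<^sub>s \<sigma>\<^sub>t\<^sup>2\<close> with \<open>s \<ge> t\<close> are needed as well.\<close>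

definition predictable :: "int \<Rightarrow> ('a \<Rightarrow> real) \<Rightarrow> bool" where
  "predictable n U \<longleftrightarrow> (\<exists>g \<in> borel_measurable (seq_space UNIV \<Otimes>\<^sub>M seq_space {..<n}).
     \<forall>\<omega>. U \<omega> = g (\<lambda>t. L t \<omega>, \<lambda>t\<in>{..<n}. \<epsilon> t \<omega>))"

lemma noise_indep: "indep_vars (\<lambda>_. borel) \<epsilon> UNIV"
  using iid by (simp add: iid_process_def)

lemma noise_stationary: "strictly_stationary M \<epsilon>"
  using iid by (rule iid_process_strictly_stationary)

lemma noise_measurable [measurable]: "\<epsilon> t \<in> borel_measurable M"
  using noise_stationary by (simp add: strictly_stationary_def)

lemma liquidity_measurable [measurable]: "L t \<in> borel_measurable M"
  using liquidity_stationary by (simp add: strictly_stationary_def)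

lemma X_measurable [measurable]: "X t \<in> borel_measurable M"
  using model by (simp add: generalized_arch_model_def)

lemma vol_term_measurable [measurable]: "vol_term t i \<in> borel_measurable M"
  unfolding vol_term_def by measurable

lemma vol_measurable [measurable]: "vol t \<in> borel_measurable M"
  unfolding vol_def by measurable

text \<open>Two independences are combined by \<open>indep_rv_assoc\<close>: the liquidity is
  independent of the whole noise, and \<open>\<epsilon> n\<close> is independent of the earlier
  noise.\<close>

lemma liquidity_noise_past_indep:
  "indep_rv (seq_space UNIV \<Otimes>\<^sub>M seq_space {..<n}) (\<lambda>\<omega>. (\<lambda>t. L t \<omega>, \<lambda>t\<in>{..<n}. \<epsilon> t \<omega>))
     borel (\<epsilon> n)"
proof (rule indep_rv_assoc)
  have "indep_var (seq_space {..<n}) (\<lambda>\<omega>. \<lambda>t\<in>{..<n}. \<epsilon> t \<omega>) (seq_space {n}) (\<lambda>\<omega>. \<lambda>t\<in>{n}. \<epsilon> t \<omega>)"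
    using noise_indep by (rule indep_var_restrict) auto
  then have "indep_rv (seq_space {..<n}) (\<lambda>\<omega>. \<lambda>t\<in>{..<n}. \<epsilon> t \<omega>)
      borel (\<lambda>\<omega>. (\<lambda>t\<in>{n}. \<epsilon> t \<omega>) n)"
    unfolding indep_rv_iff_indep_var[symmetric]
    by (rule indep_rv_compose[where g = "\<lambda>f. f n"]) simp_all
  then show "indep_rv (seq_space {..<n}) (\<lambda>\<omega>. \<lambda>t\<in>{..<n}. \<epsilon> t \<omega>) borel (\<epsilon> n)"
    by simp
  have "indep_rv (seq_space UNIV) (\<lambda>\<omega> t. L t \<omega>) (seq_space UNIV) (\<lambda>\<omega> t. \<epsilon> t \<omega>)"
    using independent by (simp add: independent_processes_def indep_rv_iff_indep_var)
  \<comment> \<open>The noise path is mapped to the pair consisting of its past and its present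
    value.\<close>
  then show "indep_rv (seq_space UNIV) (\<lambda>\<omega> t. L t \<omega>) (seq_space {..<n} \<Otimes>\<^sub>M borel)
      (\<lambda>\<omega>. (\<lambda>t\<in>{..<n}. \<epsilon> t \<omega>, \<epsilon> n \<omega>))"
    by (rule indep_rv_compose[where f = "\<lambda>f. f" and g = "\<lambda>f. (restrict f {..<n}, f n)"])
      (simp_all add: measurable_restrict_subset)
qed

lemma predictable_liquidity: "predictable n (L s)"
  unfolding predictable_def
  by (rule bexI[where x = "\<lambda>p. fst p s"]) simp_all

lemma predictable_noise: "s < n \<Longrightarrow> predictable n (\<epsilon> s)"
  unfolding predictable_def
  by (rule bexI[where x = "\<lambda>p. snd p s"]) simp_all

lemma predictable_borel2:
  assumes "predictable n U" "predictable n V"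
    and h: "(\<lambda>(u, v). h u v) \<in> borel_measurable (borel \<Otimes>\<^sub>M borel)"
  shows "predictable n (\<lambda>\<omega>. h (U \<omega>) (V \<omega>))"
proof -
  obtain f g where f: "f \<in> borel_measurable (seq_space UNIV \<Otimes>\<^sub>M seq_space {..<n})"
      "\<And>\<omega>. U \<omega> = f (\<lambda>t. L t \<omega>, \<lambda>t\<in>{..<n}. \<epsilon> t \<omega>)"
    and g: "g \<in> borel_measurable (seq_space UNIV \<Otimes>\<^sub>M seq_space {..<n})"
      "\<And>\<omega>. V \<omega> = g (\<lambda>t. L t \<omega>, \<lambda>t\<in>{..<n}. \<epsilon> t \<omega>)"
    using assms(1,2) unfolding predictable_def by blast
  have "(\<lambda>p. h (f p) (g p)) \<in> borel_measurable (seq_space UNIV \<Otimes>\<^sub>M seq_space {..<n})"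
    using measurable_compose[OF measurable_Pair[OF f(1) g(1)] h] by simp
  then show ?thesis
    unfolding predictable_def f(2) g(2) by (rule bexI[rotated]) simp
qed

text \<open>The series for \<open>vol s\<close> uses noise at times \<open>s - 1\<close> and earlier
  only, all of them below \<open>n\<close>.\<close>

lemma predictable_vol:
  assumes "s \<le> n"
  shows "predictable n (vol s)"
  unfolding predictable_def
proof (rule bexI)
  let ?g = "\<lambda>p. \<Sum>i. (\<Prod>j<i. \<alpha>\<^sub>1 * (snd p (s - 1 - int j))\<^sup>2) * (\<alpha>\<^sub>0 + l\<^sub>1 * fst p (s - 1 - int i))"
  show "\<forall>\<omega>. vol s \<omega> = ?g (\<lambda>t. L t \<omega>, \<lambda>t\<in>{..<n}. \<epsilon> t \<omega>)"
    using assms by (simp add: vol_def vol_term_def)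
  have [measurable]: "(\<lambda>p. snd p (s - 1 - int j))
      \<in> borel_measurable (seq_space UNIV \<Otimes>\<^sub>M seq_space {..<n})" for j
    using assms
    by (intro measurable_compose[OF measurable_snd] measurable_component_singleton) simp
  show "?g \<in> borel_measurable (seq_space UNIV \<Otimes>\<^sub>M seq_space {..<n})"
    by measurable
qed

text \<open>\<open>U\<close> is a function of the liquidity and the past noise, a pair independent
  of \<open>\<epsilon> n\<close>, so expectations of products factor.\<close>

lemma
  assumes U: "predictable n U" "integrable M U"
    and h [measurable]: "h \<in> borel_measurable borel" and "integrable M (\<lambda>\<omega>. h (\<epsilon> n \<omega>))"
  shows predictable_mult_integrable: "integrable M (\<lambda>\<omega>. U \<omega> * h (\<epsilon> n \<omega>))"
    and predictable_mult_expectation: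
      "expectation (\<lambda>\<omega>. U \<omega> * h (\<epsilon> n \<omega>)) = expectation U * expectation (\<lambda>\<omega>. h (\<epsilon> n \<omega>))"
proof -
  obtain g where g: "g \<in> borel_measurable (seq_space UNIV \<Otimes>\<^sub>M seq_space {..<n})"
    "\<And>\<omega>. U \<omega> = g (\<lambda>t. L t \<omega>, \<lambda>t\<in>{..<n}. \<epsilon> t \<omega>)"
    using U(1) unfolding predictable_def by blast
  have "indep_var borel U borel (\<lambda>\<omega>. h (\<epsilon> n \<omega>))"
    using indep_rv_compose[OF liquidity_noise_past_indep g(1) h]
    by (simp add: indep_rv_iff_indep_var g(2)[symmetric])
  then show "integrable M (\<lambda>\<omega>. U \<omega> * h (\<epsilon> n \<omega>))"
    "expectation (\<lambda>\<omega>. U \<omega> * h (\<epsilon> n \<omega>)) = expectation U * expectation (\<lambda>\<omega>. h (\<epsilon> n \<omega>))"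
    using assms by (simp_all add: indep_var_integrable indep_var_lebesgue_integral)
qed

section \<open>Moments of noise and liquidity at arbitrary times\<close>

lemma noise_sq_moments:
  "integrable M (\<lambda>\<omega>. (\<epsilon> t \<omega>)\<^sup>2)" "expectation (\<lambda>\<omega>. (\<epsilon> t \<omega>)\<^sup>2) = 1"
  using strictly_stationary_integrable[OF noise_stationary, of "\<lambda>x. x\<^sup>2" t]
    strictly_stationary_integral[OF noise_stationary, of "\<lambda>x. x\<^sup>2" t]
    noise_sq_integrable noise_sq_mean
  by simp_all

lemma noise_4_moments:
  "integrable M (\<lambda>\<omega>. (\<epsilon> t \<omega>) ^ 4)"
  "expectation (\<lambda>\<omega>. (\<epsilon> t \<omega>) ^ 4) = expectation (\<lambda>\<omega>. (\<epsilon> 0 \<omega>) ^ 4)"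
  using strictly_stationary_integrable[OF noise_stationary, of "\<lambda>x. x ^ 4" t]
    strictly_stationary_integral[OF noise_stationary, of "\<lambda>x. x ^ 4" t] noise_4_integrable
  by simp_all

lemma liquidity_integrable [simp]: "integrable M (L t)"
  and liquidity_sq_integrable' [simp]: "integrable M (\<lambda>\<omega>. (L t \<omega>)\<^sup>2)"
  and liquidity_mean' [simp]: "expectation (L t) = 1"
proof -
  show "integrable M (\<lambda>\<omega>. (L t \<omega>)\<^sup>2)"
    using strictly_stationary_integrable[OF liquidity_stationary, of "\<lambda>x. x\<^sup>2" t] liquidity_sq_integrable
    by simp
  then show "integrable M (L t)"
    by (rule square_integrable_imp_integrable[rotated]) simp
  show "expectation (L t) = 1"
    using strictly_stationary_integral[OF liquidity_stationary, of "\<lambda>x. x" t] liquidity_mean by simp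
qed

lemma noise_variance:
  "integrable M (\<lambda>\<omega>. ((\<epsilon> t \<omega>)\<^sup>2 - 1)\<^sup>2)"
  "expectation (\<lambda>\<omega>. ((\<epsilon> t \<omega>)\<^sup>2 - 1)\<^sup>2) = expectation (\<lambda>\<omega>. (\<epsilon> 0 \<omega>) ^ 4) - 1"
proof -
  have eq: "((\<epsilon> t \<omega>)\<^sup>2 - 1)\<^sup>2 = (\<epsilon> t \<omega>) ^ 4 - 2 * (\<epsilon> t \<omega>)\<^sup>2 + 1" for \<omega>
    by (simp add: power2_diff power_mult[symmetric])
  show "integrable M (\<lambda>\<omega>. ((\<epsilon> t \<omega>)\<^sup>2 - 1)\<^sup>2)"
    "expectation (\<lambda>\<omega>. ((\<epsilon> t \<omega>)\<^sup>2 - 1)\<^sup>2) = expectation (\<lambda>\<omega>. (\<epsilon> 0 \<omega>) ^ 4) - 1"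
    unfolding eq using noise_sq_moments[of t] noise_4_moments[of t] by (simp_all add: prob_space)
qed

text \<open>The difference of the two sides is the variance of the squared noise. The bound makes
  \<open>rate\<close> positive and allows division by the fourth moment.\<close>

lemma noise_4_ge_1: "1 \<le> expectation (\<lambda>\<omega>. (\<epsilon> 0 \<omega>) ^ 4)"
proof -
  have "0 \<le> expectation (\<lambda>\<omega>. ((\<epsilon> 0 \<omega>)\<^sup>2 - 1)\<^sup>2)"
    by simp
  then show ?thesis
    unfolding noise_variance by simp
qed

section \<open>Square integrability of the squared volatility\<close>

text \<open>This is the \<open>L\<^sup>2\<close> norm of \<open>\<alpha>\<^sub>1\<close> times the
  squared noise, the factor by which the norm of \<open>vol_term t i\<close> shrinks when
  \<open>i\<close> grows by one; \<open>\<alpha>\<^sub>1_less\<close> puts it below 1.\<close>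

definition rate :: real where
  "rate = \<alpha>\<^sub>1 * sqrt (expectation (\<lambda>\<omega>. (\<epsilon> 0 \<omega>) ^ 4))"

lemma rate: "0 < rate" "rate < 1" "rate\<^sup>2 = \<alpha>\<^sub>1\<^sup>2 * expectation (\<lambda>\<omega>. (\<epsilon> 0 \<omega>) ^ 4)"
  using noise_4_ge_1 coeffs \<alpha>\<^sub>1_less by (simp_all add: rate_def field_simps)

text \<open>The noise factors stand at \<open>i\<close> distinct times and the liquidity is
  independent of them, so the second moment factors; each noise factor contributes the square of
  \<open>rate\<close>.\<close>

lemma vol_term_sq:
  "integrable M (\<lambda>\<omega>. (vol_term t i \<omega>)\<^sup>2)" (is ?int)
  "expectation (\<lambda>\<omega>. (vol_term t i \<omega>)\<^sup>2) =
     (rate\<^sup>2) ^ i * expectation (\<lambda>\<omega>. (\<alpha>\<^sub>0 + l\<^sub>1 * L 0 \<omega>)\<^sup>2)" (is ?eq)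
proof -
  \<comment> \<open>The product over \<open>j<i\<close> is rewritten over the set of noise times,
    the form to which independence of the noise applies directly.\<close>
  let ?S = "(\<lambda>j. t - 1 - int j) ` {..<i}"
  let ?f = "\<lambda>s \<omega>. (\<alpha>\<^sub>1 * (\<epsilon> s \<omega>)\<^sup>2)\<^sup>2"
  let ?W = "\<lambda>s \<omega>. (\<alpha>\<^sub>0 + l\<^sub>1 * L s \<omega>)\<^sup>2"
  have inj: "inj_on (\<lambda>j. t - 1 - int j) {..<i}"
    by (auto simp: inj_on_def)
  have f_eq: "?f s \<omega> = \<alpha>\<^sub>1\<^sup>2 * (\<epsilon> s \<omega>) ^ 4" for s \<omega>
    by (simp add: power_mult_distrib power_mult[symmetric])
  have f: "integrable M (?f s)" "expectation (?f s) = rate\<^sup>2" for s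
    unfolding f_eq rate using noise_4_moments[of s] by simp_all
  have "indep_vars (\<lambda>_. borel) ?f ?S"
    by (rule indep_vars_compose2[OF indep_vars_subset[OF noise_indep subset_UNIV],
          where Y = "\<lambda>_ x. (\<alpha>\<^sub>1 * x\<^sup>2)\<^sup>2"]) simp
  note prods = indep_vars_integrable[OF _ this] indep_vars_lebesgue_integral[OF _ this]
  have P: "integrable M (\<lambda>\<omega>. \<Prod>s\<in>?S. ?f s \<omega>)" "expectation (\<lambda>\<omega>. \<Prod>s\<in>?S. ?f s \<omega>) = (rate\<^sup>2) ^ i"
    using prods f by (simp_all add: card_image[OF inj])
  have W: "integrable M (?W s)" "expectation (?W s) = expectation (?W 0)" for s
  proof -
    show "integrable M (?W s)"
      by (rule integrable_square_add) (simp_all add: power_mult_distrib)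
    show "expectation (?W s) = expectation (?W 0)"
      by (rule strictly_stationary_integral[OF liquidity_stationary, of "\<lambda>x. (\<alpha>\<^sub>0 + l\<^sub>1 * x)\<^sup>2"]) simp
  qed
  have "indep_rv (seq_space UNIV) (\<lambda>\<omega> t. L t \<omega>) (seq_space UNIV) (\<lambda>\<omega> t. \<epsilon> t \<omega>)"
    using independent by (simp add: independent_processes_def indep_rv_iff_indep_var)
  then have "indep_rv borel (?W (t - 1 - int i)) borel (\<lambda>\<omega>. \<Prod>s\<in>?S. ?f s \<omega>)"
    by (rule indep_rv_compose[where f = "\<lambda>p. (\<alpha>\<^sub>0 + l\<^sub>1 * p (t - 1 - int i))\<^sup>2" and
          g = "\<lambda>p. \<Prod>s\<in>?S. (\<alpha>\<^sub>1 * (p s)\<^sup>2)\<^sup>2"]) measurable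
  then have ind: "indep_var borel (?W (t - 1 - int i)) borel (\<lambda>\<omega>. \<Prod>s\<in>?S. ?f s \<omega>)"
    by (simp add: indep_rv_iff_indep_var)
  have eq: "(vol_term t i \<omega>)\<^sup>2 = ?W (t - 1 - int i) \<omega> * (\<Prod>s\<in>?S. ?f s \<omega>)" for \<omega>
    by (simp add: vol_term_def prod.reindex[OF inj] power_mult_distrib prod_power_distrib)
  show ?int
    unfolding eq using indep_var_integrable[OF ind W(1) P(1)] .
  show ?eq
    unfolding eq using indep_var_lebesgue_integral[OF ind W(1) P(1)] W(2)[of "t - 1 - int i"] P(2)
    by simp
qed

lemma AE_vol_term_nonneg: "AE \<omega> in M. \<forall>i. 0 \<le> vol_term t i \<omega>"
proof -
  have "AE \<omega> in M. \<forall>s. 0 < L s \<omega>"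
    using liquidity_pos by (simp add: AE_all_countable)
  then show ?thesis
  proof eventually_elim
    case (elim \<omega>)
    then have "0 \<le> L s \<omega>" for s
      by (simp add: less_imp_le)
    then show ?case
      unfolding vol_term_def using coeffs
      by (intro allI mult_nonneg_nonneg prod_nonneg add_nonneg_nonneg) simp_all
  qed
qed

text \<open>The weighted Cauchy-Schwarz inequality with \<open>q = rate\<close> dominates the square
  of the series by a series whose expectations \<open>K * rate ^ i\<close> are summable.\<close>

lemma vol_sq_integrable [simp]: "integrable M (\<lambda>\<omega>. (vol t \<omega>)\<^sup>2)"
proof -
  define K where "K = expectation (\<lambda>\<omega>. (\<alpha>\<^sub>0 + l\<^sub>1 * L 0 \<omega>)\<^sup>2)"
  let ?r = "\<lambda>i \<omega>. (vol_term t i \<omega>)\<^sup>2 / rate ^ i"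
  have r: "integrable M (?r i)" "expectation (?r i) = K * rate ^ i" for i
  proof -
    show "integrable M (?r i)"
      using vol_term_sq(1) by simp
    have "expectation (?r i) = (rate\<^sup>2) ^ i * K / rate ^ i"
      by (simp add: vol_term_sq(2) K_def)
    also have "(rate\<^sup>2) ^ i = rate ^ i * rate ^ i"
      by (simp add: power2_eq_square power_mult_distrib)
    finally show "expectation (?r i) = K * rate ^ i"
      using rate(1) by simp
  qed
  have "0 \<le> K"
    by (simp add: K_def)
  \<comment> \<open>Monotone convergence in the extended reals comes first: a finite expectation of
    the sum forces almost sure convergence of the real series.\<close>
  have "(\<integral>\<^sup>+\<omega>. (\<Sum>i. ennreal (?r i \<omega>)) \<partial>M) = (\<Sum>i. \<integral>\<^sup>+\<omega>. ennreal (?r i \<omega>) \<partial>M)"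
    by (rule nn_integral_suminf) measurable
  also have "\<dots> = (\<Sum>i. ennreal (K * rate ^ i))"
    using r rate by (intro suminf_cong) (simp add: nn_integral_eq_integral)
  also have "\<dots> = ennreal (\<Sum>i. K * rate ^ i)"
    using rate \<open>0 \<le> K\<close> by (intro suminf_ennreal2 summable_mult summable_geometric) auto
  finally have "(\<integral>\<^sup>+\<omega>. (\<Sum>i. ennreal (?r i \<omega>)) \<partial>M) \<noteq> \<infinity>"
    by simp
  then have "AE \<omega> in M. (\<Sum>i. ennreal (?r i \<omega>)) \<noteq> \<infinity>"
    by (rule nn_integral_PInf_AE[rotated]) measurable
  then have summable: "AE \<omega> in M. summable (\<lambda>i. ?r i \<omega>)"
    by eventually_elim (use rate in \<open>auto intro!: summable_suminf_not_top\<close>)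
  have "integrable M (\<lambda>\<omega>. \<Sum>i. ?r i \<omega>)"
  proof (rule integrable_suminf)
    show "AE \<omega> in M. summable (\<lambda>i. norm (?r i \<omega>))"
      using summable rate by simp
    have "(\<lambda>i. expectation (\<lambda>\<omega>. norm (?r i \<omega>))) = (\<lambda>i. K * rate ^ i)"
      using r(2) rate by simp
    then show "summable (\<lambda>i. expectation (\<lambda>\<omega>. norm (?r i \<omega>)))"
      using rate by (simp add: summable_mult summable_geometric)
  qed (fact r)
  then have "integrable M (\<lambda>\<omega>. (\<Sum>i. ?r i \<omega>) / (1 - rate))"
    by simp
  moreover have "(\<lambda>\<omega>. (vol t \<omega>)\<^sup>2) \<in> borel_measurable M"
    by measurable
  moreover have "AE \<omega> in M. norm ((vol t \<omega>)\<^sup>2) \<le> norm ((\<Sum>i. ?r i \<omega>) / (1 - rate))"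
    using summable AE_vol_term_nonneg[of t]
  proof eventually_elim
    case (elim \<omega>)
    have "(vol t \<omega>)\<^sup>2 \<le> (\<Sum>i. ?r i \<omega>) / (1 - rate)"
      unfolding vol_def using elim rate by (intro weighted_Cauchy_Schwarz_suminf) auto
    then show ?case
      by (simp only: real_norm_def abs_power2 order_trans[OF _ abs_ge_self])
  qed
  ultimately show ?thesis
    by (rule Bochner_Integration.integrable_bound)
qed

lemma vol_integrable [simp]: "integrable M (vol t)"
  by (rule square_integrable_imp_integrable) simp_all

section \<open>The squared process: recursion, stationarity and fourth moment\<close>

lemma AE_X_sq: "AE \<omega> in M. (X t \<omega>)\<^sup>2 = vol t \<omega> * (\<epsilon> t \<omega>)\<^sup>2"
proof -
  have "AE \<omega> in M. X t \<omega> = \<sigma> t \<omega> * \<epsilon> t \<omega>"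
    using model by (simp add: generalized_arch_model_def)
  moreover have "AE \<omega> in M. (\<sigma> t \<omega>)\<^sup>2 = vol t \<omega>"
    using solution[of "t - 1"] by (simp add: vol_def vol_term_def)
  ultimately show ?thesis
    by eventually_elim (simp add: power_mult_distrib)
qed

lemma AE_vol_recursion: "AE \<omega> in M. vol t \<omega> = \<alpha>\<^sub>0 + \<alpha>\<^sub>1 * (X (t - 1) \<omega>)\<^sup>2 + l\<^sub>1 * L (t - 1) \<omega>"
proof -
  have "AE \<omega> in M. (\<sigma> t \<omega>)\<^sup>2 = \<alpha>\<^sub>0 + \<alpha>\<^sub>1 * (X (t - 1) \<omega>)\<^sup>2 + l\<^sub>1 * L (t - 1) \<omega>"
    using model by (simp add: generalized_arch_model_def)
  moreover have "AE \<omega> in M. (\<sigma> t \<omega>)\<^sup>2 = vol t \<omega>"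
    using solution[of "t - 1"] by (simp add: vol_def vol_term_def)
  ultimately show ?thesis
    by eventually_elim simp
qed

text \<open>At each time, the squared process is almost surely the same functional \<open>?H\<close>
  of the liquidity and noise paths shifted by that time.\<close>

lemma X_sq_stationary: "strictly_stationary M (\<lambda>t \<omega>. (X t \<omega>)\<^sup>2)"
proof (rule strictly_stationary_factor[OF liquidity_stationary noise_stationary independent])
  let ?H = "\<lambda>p. (\<Sum>i. (\<Prod>j<i. \<alpha>\<^sub>1 * (snd p (- 1 - int j))\<^sup>2) * (\<alpha>\<^sub>0 + l\<^sub>1 * fst p (- 1 - int i)))
    * (snd p 0)\<^sup>2"
  show "?H \<in> borel_measurable (seq_space UNIV \<Otimes>\<^sub>M seq_space UNIV)"
    by measurable
  show "AE \<omega> in M. (X t \<omega>)\<^sup>2 = ?H (\<lambda>s. L (s + t) \<omega>, \<lambda>s. \<epsilon> (s + t) \<omega>)" for t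
  proof -
    have shift: "- 1 - int j + t = t - 1 - int j" for j
      by simp
    have "?H (\<lambda>s. L (s + t) \<omega>, \<lambda>s. \<epsilon> (s + t) \<omega>) = vol t \<omega> * (\<epsilon> t \<omega>)\<^sup>2" for \<omega>
      unfolding vol_def vol_term_def fst_conv snd_conv shift by simp
    then show ?thesis
      by (simp only: AE_X_sq)
  qed
  show "(\<lambda>\<omega>. (X t \<omega>)\<^sup>2) \<in> borel_measurable M" for t
    by measurable
qed

lemma predictable_vol_sq: "predictable t (\<lambda>\<omega>. (vol t \<omega>)\<^sup>2)"
  unfolding power2_eq_square
  by (rule predictable_borel2[OF predictable_vol predictable_vol]) simp_all

text \<open>The fourth power of \<open>X t\<close> is almost surely the square of
  \<open>vol t\<close>, which is predictable, times the fourth power of the independent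
  \<open>\<epsilon> t\<close>.\<close>

lemma X_4_integrable: "integrable M (\<lambda>\<omega>. ((X t \<omega>)\<^sup>2)\<^sup>2)"
  and X_4_expectation: "expectation (\<lambda>\<omega>. (X t \<omega>) ^ 4) =
    expectation (\<lambda>\<omega>. (vol t \<omega>)\<^sup>2) * expectation (\<lambda>\<omega>. (\<epsilon> 0 \<omega>) ^ 4)"
proof -
  have AE_eq: "AE \<omega> in M. ((X t \<omega>)\<^sup>2)\<^sup>2 = (vol t \<omega>)\<^sup>2 * (\<epsilon> t \<omega>) ^ 4"
    using AE_X_sq[of t] by eventually_elim (simp add: power_mult_distrib flip: power_mult)
  note mult = predictable_mult_integrable[OF predictable_vol_sq vol_sq_integrable, of "\<lambda>x. x ^ 4"]
    predictable_mult_expectation[OF predictable_vol_sq vol_sq_integrable, of "\<lambda>x. x ^ 4"]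
  show "integrable M (\<lambda>\<omega>. ((X t \<omega>)\<^sup>2)\<^sup>2)"
    by (rule integrable_cong_AE_imp[OF mult(1)]) (use AE_eq noise_4_moments in auto)
  have "expectation (\<lambda>\<omega>. (X t \<omega>) ^ 4) = expectation (\<lambda>\<omega>. (vol t \<omega>)\<^sup>2 * (\<epsilon> t \<omega>) ^ 4)"
    by (rule integral_cong_AE) (use AE_eq in \<open>auto simp flip: power_mult\<close>)
  then show "expectation (\<lambda>\<omega>. (X t \<omega>) ^ 4) =
      expectation (\<lambda>\<omega>. (vol t \<omega>)\<^sup>2) * expectation (\<lambda>\<omega>. (\<epsilon> 0 \<omega>) ^ 4)"
    using mult(2) noise_4_moments[of t] by simp
qed

section \<open>Innovations and their orthogonality\<close>

text \<open>By \<open>AE_X_sq\<close> this is almost surely the squared process minus the squared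
  volatility, that is, its one-step prediction error.\<close>

definition innov :: "int \<Rightarrow> 'a \<Rightarrow> real" where
  "innov t \<omega> = vol t \<omega> * ((\<epsilon> t \<omega>)\<^sup>2 - 1)"

lemma innov_measurable [measurable]: "innov t \<in> borel_measurable M"
  unfolding innov_def by measurable

lemma predictable_centered_expectation:
  assumes "predictable t U" "integrable M U"
  shows "expectation (\<lambda>\<omega>. U \<omega> * ((\<epsilon> t \<omega>)\<^sup>2 - 1)) = 0"
  using predictable_mult_expectation[OF assms, of "\<lambda>x. x\<^sup>2 - 1"] noise_sq_moments[of t]
  by (simp add: prob_space)

lemma innov_sq_integrable [simp]: "integrable M (\<lambda>\<omega>. (innov t \<omega>)\<^sup>2)"
  and innov_sq_expectation: "expectation (\<lambda>\<omega>. (innov t \<omega>)\<^sup>2) =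
    expectation (\<lambda>\<omega>. (vol t \<omega>)\<^sup>2) * (expectation (\<lambda>\<omega>. (\<epsilon> 0 \<omega>) ^ 4) - 1)"
proof -
  from predictable_mult_integrable[OF predictable_vol_sq vol_sq_integrable, of "\<lambda>x. (x\<^sup>2 - 1)\<^sup>2"]
    predictable_mult_expectation[OF predictable_vol_sq vol_sq_integrable, of "\<lambda>x. (x\<^sup>2 - 1)\<^sup>2"]
  show "integrable M (\<lambda>\<omega>. (innov t \<omega>)\<^sup>2)"
    "expectation (\<lambda>\<omega>. (innov t \<omega>)\<^sup>2) =
      expectation (\<lambda>\<omega>. (vol t \<omega>)\<^sup>2) * (expectation (\<lambda>\<omega>. (\<epsilon> 0 \<omega>) ^ 4) - 1)"
    using noise_variance[of t] by (simp_all add: innov_def power_mult_distrib)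
qed

lemma innov_expectation: "expectation (innov t) = 0"
  unfolding innov_def by (rule predictable_centered_expectation) (simp_all add: predictable_vol)

text \<open>The liquidity at any time \<open>s\<close>, even after \<open>t\<close>, counts as
  predictable at \<open>t\<close>; hence so does \<open>L s\<close> times \<open>vol t\<close>, and
  the centred squared noise is independent of it.\<close>

lemma liquidity_innov_expectation:
  "expectation (\<lambda>\<omega>. L s \<omega> * innov t \<omega>) = 0"
proof -
  have "predictable t (\<lambda>\<omega>. L s \<omega> * vol t \<omega>)"
    by (rule predictable_borel2[OF predictable_liquidity predictable_vol]) simp_all
  moreover have "integrable M (\<lambda>\<omega>. L s \<omega> * vol t \<omega>)"
    by (rule integrable_mult_of_squares) simp_all
  ultimately have "expectation (\<lambda>\<omega>. L s \<omega> * vol t \<omega> * ((\<epsilon> t \<omega>)\<^sup>2 - 1)) = 0"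
    by (rule predictable_centered_expectation)
  then show ?thesis
    by (simp add: innov_def mult.assoc)
qed

text \<open>The earlier innovation is predictable at the later time, where it is multiplied by a
  centred independent factor.\<close>

lemma innov_orthogonal:
  assumes "s \<noteq> t"
  shows "expectation (\<lambda>\<omega>. innov s \<omega> * innov t \<omega>) = 0"
proof -
  have *: "expectation (\<lambda>\<omega>. innov s \<omega> * innov t \<omega>) = 0" if "s < t" for s t
  proof -
    have "predictable t (innov s)"
      unfolding innov_def using that
      by (intro predictable_borel2[OF predictable_vol predictable_noise, where h = "\<lambda>u v. u * (v\<^sup>2 - 1)"])
        simp_all
    then have "predictable t (\<lambda>\<omega>. innov s \<omega> * vol t \<omega>)"
      by (rule predictable_borel2[OF _ predictable_vol]) simp_all
    moreover have "integrable M (\<lambda>\<omega>. innov s \<omega> * vol t \<omega>)"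
      by (rule integrable_mult_of_squares) simp_all
    ultimately have "expectation (\<lambda>\<omega>. innov s \<omega> * vol t \<omega> * ((\<epsilon> t \<omega>)\<^sup>2 - 1)) = 0"
      by (rule predictable_centered_expectation)
    then show ?thesis
      by (simp add: innov_def[of t] mult.assoc)
  qed
  show ?thesis
    using assms *[of s t] *[of t s] by (cases s t rule: linorder_cases) (simp_all add: mult.commute)
qed

section \<open>The autocovariance equations\<close>

text \<open>Both cases of the theorem come from this one identity: the innovation term vanishes for
  nonzero \<open>n\<close> and is a second moment for \<open>n = 0\<close>.\<close>

lemma autocovariance_recursion:
  defines "\<gamma> \<equiv> autocovariance M (\<lambda>t \<omega>. (X t \<omega>)\<^sup>2)" and "s \<equiv> autocovariance M L"
  shows "(1 + \<alpha>\<^sub>1\<^sup>2) * \<gamma> n - \<alpha>\<^sub>1 * (\<gamma> (n + 1) + \<gamma> (n - 1)) =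
    l\<^sub>1\<^sup>2 * s n + expectation (\<lambda>\<omega>. innov 0 \<omega> * innov n \<omega>)"
proof -
  define \<mu> where "\<mu> = expectation (\<lambda>\<omega>. (X 0 \<omega>)\<^sup>2)"
  define y where "y t \<omega> = (X t \<omega>)\<^sup>2 - \<mu>" for t \<omega>
  define \<Lambda> where "\<Lambda> t \<omega> = L t \<omega> - 1" for t \<omega>
  have [measurable]: "y t \<in> borel_measurable M" "\<Lambda> t \<in> borel_measurable M" for t
    unfolding y_def \<Lambda>_def by measurable
  have X_int: "integrable M (\<lambda>\<omega>. (X t \<omega>)\<^sup>2)" for t
    using X_4_integrable by (rule square_integrable_imp_integrable[rotated]) simp
  have mean: "expectation (\<lambda>\<omega>. (X t \<omega>)\<^sup>2) = \<mu>" for t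
    using strictly_stationary_integral[OF X_sq_stationary, of "\<lambda>x. x" t] by (simp add: \<mu>_def)
  have y_sq: "integrable M (\<lambda>\<omega>. (y t \<omega>)\<^sup>2)" and \<Lambda>_sq: "integrable M (\<lambda>\<omega>. (\<Lambda> t \<omega>)\<^sup>2)" for t
    using X_4_integrable[of t] X_int[of t] by (simp_all add: y_def \<Lambda>_def power2_diff)
  have yy: "integrable M (\<lambda>\<omega>. y t \<omega> * y u \<omega>)" and \<Lambda>\<Lambda>: "integrable M (\<lambda>\<omega>. \<Lambda> t \<omega> * \<Lambda> u \<omega>)"
    and \<Lambda>D: "integrable M (\<lambda>\<omega>. \<Lambda> t \<omega> * innov u \<omega>)"
    and DD: "integrable M (\<lambda>\<omega>. innov t \<omega> * innov u \<omega>)" for t u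
    by (simp_all add: integrable_mult_of_squares y_sq \<Lambda>_sq)
  have \<Lambda>D_0: "expectation (\<lambda>\<omega>. \<Lambda> t \<omega> * innov u \<omega>) = 0" for t u
  proof -
    have "integrable M (\<lambda>\<omega>. L t \<omega> * innov u \<omega>)" "integrable M (innov u)"
      by (auto intro: integrable_mult_of_squares square_integrable_imp_integrable)
    then show ?thesis
      by (simp add: \<Lambda>_def left_diff_distrib liquidity_innov_expectation innov_expectation)
  qed
  have \<gamma>_eq: "expectation (\<lambda>\<omega>. y t \<omega> * y u \<omega>) = \<gamma> (u - t)" for t u
    unfolding \<gamma>_def strictly_stationary_autocovariance[OF X_sq_stationary, of _ t]
    by (simp add: covariance_def mean y_def)
  have s_eq: "expectation (\<lambda>\<omega>. \<Lambda> t \<omega> * \<Lambda> u \<omega>) = s (u - t)" for t u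
    unfolding s_def strictly_stationary_autocovariance[OF liquidity_stationary, of _ t]
    by (simp add: covariance_def \<Lambda>_def)
  \<comment> \<open>The mean equation for \<open>\<mu>\<close> is obtained by taking expectations in
    the volatility recursion at time 1; the squared noise has mean 1, so \<open>vol 1\<close> has
    mean \<open>\<mu>\<close> too.\<close>
  have "\<mu> = expectation (vol t)" for t
  proof -
    have "\<mu> = expectation (\<lambda>\<omega>. vol t \<omega> * (\<epsilon> t \<omega>)\<^sup>2)"
      unfolding mean[of t, symmetric] by (rule integral_cong_AE) (use AE_X_sq in auto)
    also have "\<dots> = expectation (vol t)"
      using predictable_mult_expectation[OF predictable_vol vol_integrable, of t t "\<lambda>x. x\<^sup>2"]
        noise_sq_moments[of t] by simp
    finally show ?thesis .
  qed
  also have "expectation (vol 1) = expectation (\<lambda>\<omega>. \<alpha>\<^sub>0 + \<alpha>\<^sub>1 * (X 0 \<omega>)\<^sup>2 + l\<^sub>1 * L 0 \<omega>)"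
    by (rule integral_cong_AE) (use AE_vol_recursion[of 1] in auto)
  also have "\<dots> = \<alpha>\<^sub>0 + \<alpha>\<^sub>1 * \<mu> + l\<^sub>1"
    using X_int mean by (simp add: prob_space)
  finally have \<mu>: "\<mu> = \<alpha>\<^sub>0 + \<alpha>\<^sub>1 * \<mu> + l\<^sub>1" .
  \<comment> \<open>After centring, the constants cancel precisely by the equation for
    \<open>\<mu>\<close>.\<close>
  have AR: "AE \<omega> in M. y t \<omega> - \<alpha>\<^sub>1 * y (t - 1) \<omega> = l\<^sub>1 * \<Lambda> (t - 1) \<omega> + innov t \<omega>" for t
    using AE_X_sq[of t] AE_vol_recursion[of t]
  proof eventually_elim
    case (elim \<omega>)
    then show ?case
      using \<mu> by (simp add: y_def \<Lambda>_def innov_def algebra_simps)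
  qed
  have "expectation (\<lambda>\<omega>. (y 0 \<omega> - \<alpha>\<^sub>1 * y (0 - 1) \<omega>) * (y n \<omega> - \<alpha>\<^sub>1 * y (n - 1) \<omega>)) =
      expectation (\<lambda>\<omega>. (l\<^sub>1 * \<Lambda> (0 - 1) \<omega> + innov 0 \<omega>) * (l\<^sub>1 * \<Lambda> (n - 1) \<omega> + innov n \<omega>))"
    by (rule integral_cong_AE) (measurable, use AR[of 0] AR[of n] in eventually_elim, simp)
  also have "(\<lambda>\<omega>. (y 0 \<omega> - \<alpha>\<^sub>1 * y (0 - 1) \<omega>) * (y n \<omega> - \<alpha>\<^sub>1 * y (n - 1) \<omega>)) =
     (\<lambda>\<omega>. y 0 \<omega> * y n \<omega> - \<alpha>\<^sub>1 * (y 0 \<omega> * y (n - 1) \<omega>) - \<alpha>\<^sub>1 * (y (-1) \<omega> * y n \<omega>)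
        + \<alpha>\<^sub>1\<^sup>2 * (y (-1) \<omega> * y (n - 1) \<omega>))"
    by (simp add: fun_eq_iff algebra_simps power2_eq_square)
  \<comment> \<open>Times \<open>-1\<close> and \<open>n\<close> are \<open>n + 1\<close> apart,
    while \<open>-1\<close> and \<open>n - 1\<close> are again \<open>n\<close> apart.\<close>
  also have "expectation \<dots> = \<gamma> n - \<alpha>\<^sub>1 * \<gamma> (n - 1) - \<alpha>\<^sub>1 * \<gamma> (n + 1) + \<alpha>\<^sub>1\<^sup>2 * \<gamma> n"
    by (simp add: yy \<gamma>_eq)
  also have "(\<lambda>\<omega>. (l\<^sub>1 * \<Lambda> (0 - 1) \<omega> + innov 0 \<omega>) * (l\<^sub>1 * \<Lambda> (n - 1) \<omega> + innov n \<omega>)) =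
     (\<lambda>\<omega>. l\<^sub>1\<^sup>2 * (\<Lambda> (-1) \<omega> * \<Lambda> (n - 1) \<omega>) + l\<^sub>1 * (\<Lambda> (-1) \<omega> * innov n \<omega>)
        + l\<^sub>1 * (\<Lambda> (n - 1) \<omega> * innov 0 \<omega>) + innov 0 \<omega> * innov n \<omega>)"
    by (simp add: fun_eq_iff algebra_simps power2_eq_square)
  also have "expectation \<dots> = l\<^sub>1\<^sup>2 * s n + expectation (\<lambda>\<omega>. innov 0 \<omega> * innov n \<omega>)"
    \<comment> \<open>Both mixed terms vanish by \<open>\<Lambda>D_0\<close>, whatever the order of
      the two times.\<close>
    by (simp add: \<Lambda>\<Lambda> \<Lambda>D DD \<Lambda>D_0 s_eq)
  finally show ?thesis
    by (simp add: algebra_simps)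
qed

text \<open>Base time \<open>n\<close> with lag \<open>- n\<close> and base time \<open>0\<close>
  with lag \<open>n\<close> involve the same two variables.\<close>

lemma autocovariance_X_sq_symmetric:
  "autocovariance M (\<lambda>t \<omega>. (X t \<omega>)\<^sup>2) (- n) = autocovariance M (\<lambda>t \<omega>. (X t \<omega>)\<^sup>2) n"
  using strictly_stationary_autocovariance[OF X_sq_stationary, of "- n" n]
    strictly_stationary_autocovariance[OF X_sq_stationary, of n 0]
  by (simp add: covariance_def mult.commute)

end

theorem lemma2p7:
  fixes M :: "'a measure"
    and \<epsilon> L \<sigma> X :: "int \<Rightarrow> 'a \<Rightarrow> real"
    and \<alpha>\<^sub>0 \<alpha>\<^sub>1 l\<^sub>1 :: real
    and \<gamma> s :: "int \<Rightarrow> real"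
  assumes "prob_space M"
    and "iid_process M \<epsilon>"
    and "integrable M (\<epsilon> 0)" and "(\<integral>\<omega>. \<epsilon> 0 \<omega> \<partial>M) = 0"
    and "integrable M (\<lambda>\<omega>. (\<epsilon> 0 \<omega>)\<^sup>2)" and "(\<integral>\<omega>. (\<epsilon> 0 \<omega>)\<^sup>2 \<partial>M) = 1"
    and "strictly_stationary M L"
    and "\<forall>t. AE \<omega> in M. L t \<omega> > 0"
    and "integrable M (L 0)" and "(\<integral>\<omega>. L 0 \<omega> \<partial>M) = 1"
    and "independent_processes M L \<epsilon>"
    and "\<alpha>\<^sub>0 \<ge> 0" and "\<alpha>\<^sub>1 > 0" and "l\<^sub>1 > 0" and "\<alpha>\<^sub>1 < 1"
    and "integrable M (\<lambda>\<omega>. (L 0 \<omega>)\<^sup>2)"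
    and "generalized_arch_model M \<alpha>\<^sub>0 \<alpha>\<^sub>1 l\<^sub>1 \<epsilon> L \<sigma> X"
    and "\<forall>t. AE \<omega> in M. (\<sigma> (t + 1) \<omega>)\<^sup>2 =
           (\<Sum>i. (\<Prod>j<i. \<alpha>\<^sub>1 * (\<epsilon> (t - int j) \<omega>)\<^sup>2) * (\<alpha>\<^sub>0 + l\<^sub>1 * L (t - int i) \<omega>))"
    and "\<gamma> = autocovariance M (\<lambda>t \<omega>. (X t \<omega>)\<^sup>2)"
    and "s = autocovariance M L"
    and "integrable M (\<lambda>\<omega>. (\<epsilon> 0 \<omega>) ^ 4)"
    and "\<alpha>\<^sub>1 < 1 / sqrt (\<integral>\<omega>. (\<epsilon> 0 \<omega>) ^ 4 \<partial>M)"
  shows "(\<forall>n. n \<noteq> 0 \<longrightarrow>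
            \<alpha>\<^sub>1\<^sup>2 * \<gamma> n - \<alpha>\<^sub>1 * (\<gamma> (n + 1) + \<gamma> (n - 1)) + \<gamma> n - l\<^sub>1\<^sup>2 * s n = 0) \<and>
         \<alpha>\<^sub>1\<^sup>2 * \<gamma> 0 - 2 * \<alpha>\<^sub>1 * \<gamma> 1 + \<gamma> 0
           - (\<integral>\<omega>. (X 0 \<omega>) ^ 4 \<partial>M) * prob_space.variance M (\<lambda>\<omega>. (\<epsilon> 0 \<omega>)\<^sup>2)
               / (\<integral>\<omega>. (\<epsilon> 0 \<omega>) ^ 4 \<partial>M)
           - l\<^sub>1\<^sup>2 * s 0 = 0"
proof -
  interpret prob_space M by fact
  interpret liquidity_arch M \<epsilon> L \<sigma> X \<alpha>\<^sub>0 \<alpha>\<^sub>1 l\<^sub>1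
    by unfold_locales (use assms in blast)+
  let ?m4 = "expectation (\<lambda>\<omega>. (\<epsilon> 0 \<omega>) ^ 4)"
  have recursion: "(1 + \<alpha>\<^sub>1\<^sup>2) * \<gamma> n - \<alpha>\<^sub>1 * (\<gamma> (n + 1) + \<gamma> (n - 1)) =
      l\<^sub>1\<^sup>2 * s n + expectation (\<lambda>\<omega>. innov 0 \<omega> * innov n \<omega>)" for n
    unfolding assms(19,20) by (rule autocovariance_recursion)
  have "\<alpha>\<^sub>1\<^sup>2 * \<gamma> n - \<alpha>\<^sub>1 * (\<gamma> (n + 1) + \<gamma> (n - 1)) + \<gamma> n - l\<^sub>1\<^sup>2 * s n = 0" if "n \<noteq> 0" for n
    using recursion[of n] innov_orthogonal[of 0 n] that by (simp add: algebra_simps)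
  moreover have "variance (\<lambda>\<omega>. (\<epsilon> 0 \<omega>)\<^sup>2) = ?m4 - 1"
    unfolding noise_sq_mean by (rule noise_variance)
  \<comment> \<open>Dividing the fourth moment of \<open>X 0\<close> by \<open>?m4\<close> leaves
    the second moment of \<open>vol 0\<close>; times \<open>?m4 - 1\<close> this is the second
    moment of the innovation.\<close>
  then have "expectation (\<lambda>\<omega>. (X 0 \<omega>) ^ 4) * variance (\<lambda>\<omega>. (\<epsilon> 0 \<omega>)\<^sup>2) / ?m4 =
      expectation (\<lambda>\<omega>. innov 0 \<omega> * innov 0 \<omega>)"
    using noise_4_ge_1 by (simp add: X_4_expectation innov_sq_expectation flip: power2_eq_square)
  \<comment> \<open>Symmetry merges the two neighbouring lags into the term with coefficient 2 at
    \<open>n = 0\<close>.\<close>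
  moreover have "\<gamma> (- 1) = \<gamma> 1"
    unfolding assms(19) by (rule autocovariance_X_sq_symmetric)
  ultimately show ?thesis
    using recursion[of 0] by (auto simp: algebra_simps)
qed

end
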